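(* Let $F=f+g$ on $\mathbb{R}^d$, where $f:\mathbb{R}^d\to\mathbb{R}$ is continuously differentiable and $L$-smooth, $g:\mathbb{R}^d\to\mathbb{R}\cup\{+\infty\}$ is proper, closed and convex, and the set of minimizers of $F$ is nonempty with finite minimum value $F^*$. Let $\mathcal{K}\subseteq\mathbb{R}^d$ and suppose $F$ satisfies the $\mathcal{K}$-restricted proximal PL inequality with constant $\nu_{\mathcal{K}}>0$. If the current iterate $x_k$ lies in $\mathcal{K}$, then the proximal gradient update with step size $1/L$, namely $x_{k+1}=\operatorname{prox}_{g/L}\left(x_k-\frac1L\nabla f(x_k)\right)$, satisfies $$F(x_{k+1})-F^*\le\left(1-\frac{\nu_{\mathcal{K}}}{L}\right)\bigl(F(x_k)-F^*\bigr).$$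
   Context: $L$-smooth (with $L>0$) means $\|\nabla f(x)-\nabla f(y)\|_2\le L\|x-y\|_2$ for all $x,y\in\mathbb{R}^d$. The function $f$ need not be convex. For $\lambda>0$, $\operatorname{prox}_{\lambda g}(x):=\operatorname{argmin}_{y\in\mathbb{R}^d}\{g(y)+\frac{1}{2\lambda}\|y-x\|_2^2\}$. Generalized gradient size: for $\alpha>0$, $$\mathcal{D}_g(x,\alpha):=-2\alpha\min_{y\in\mathbb{R}^d}\left[\langle\nabla f(x),y-x\rangle+\frac{\alpha}{2}\|y-x\|_2^2+g(y)-g(x)\right].$$ $F$ satisfies the $\mathcal{K}$-restricted proximal PL inequality with constant $\nu_{\mathcal{K}}>0$ if $\frac12\mathcal{D}_g(x,L)\ge\nu_{\mathcal{K}}(F(x)-F^* )$ for all $x\in\mathcal{K}\cap\operatorname{dom}(F)$, where $\operatorname{dom}(F)=\{x: F(x)<+\infty\}$. Convention: the right-hand side of the claimed inequality is interpreted as $+\infty$ when $F(x_k)=+\infty$. *)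

theory Defs
  imports "HOL-Analysis.Analysis"
begin

definition grad :: "('a::real_inner \<Rightarrow> real) \<Rightarrow> 'a \<Rightarrow> 'a" where
  "grad f x = (THE D. GDERIV f x :> D)"

definition continuously_differentiable :: "('a::real_inner \<Rightarrow> real) \<Rightarrow> bool" where
  "continuously_differentiable f \<longleftrightarrow>
     (\<forall>x. f differentiable (at x)) \<and> continuous_on UNIV (grad f)"

definition L_smooth :: "real \<Rightarrow> ('a::real_inner \<Rightarrow> real) \<Rightarrow> bool" where
  "L_smooth L f \<longleftrightarrow> L > 0 \<and> (\<forall>x y. norm (grad f x - grad f y) \<le> L * norm (x - y))"

text \<open>
  Functions with values in the reals extended by $+\infty$ are rendered as \<^typ>\<open>ereal\<close>-valued
  functions; that they never take the value $-\infty$ is part of properness.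
\<close>

definition proper_fun :: "('a \<Rightarrow> ereal) \<Rightarrow> bool" where
  "proper_fun g \<longleftrightarrow> (\<forall>x. g x \<noteq> -\<infinity>) \<and> (\<exists>x. g x \<noteq> \<infinity>)"

definition epi :: "('a \<Rightarrow> ereal) \<Rightarrow> ('a \<times> real) set" where
  "epi g = {(x, t). g x \<le> ereal t}"

definition closed_fun :: "('a::real_normed_vector \<Rightarrow> ereal) \<Rightarrow> bool" where
  "closed_fun g \<longleftrightarrow> closed (epi g)"

definition convex_fun :: "('a::real_vector \<Rightarrow> ereal) \<Rightarrow> bool" where
  "convex_fun g \<longleftrightarrow> convex (epi g)"

definition effective_domain :: "('a \<Rightarrow> ereal) \<Rightarrow> 'a set" where
  "effective_domain F = {x. F x < \<infinity>}"

definition minimizers :: "('a \<Rightarrow> ereal) \<Rightarrow> 'a set" where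
  "minimizers F = {x. is_arg_min F (\<lambda>_. True) x}"

text \<open>The attained minimum of a function; unspecified if the minimum is not attained.\<close>

definition min_value :: "('a \<Rightarrow> ereal) \<Rightarrow> ereal" where
  "min_value F = (LEAST v. v \<in> range F)"

text \<open>\<open>prox c g\<close> is the proximal operator of the scaled function $c \cdot g$.\<close>

definition prox :: "real \<Rightarrow> ('a::real_normed_vector \<Rightarrow> ereal) \<Rightarrow> 'a \<Rightarrow> 'a" where
  "prox c g x =
     arg_min (\<lambda>y. g y + ereal (1 / (2 * c) * (norm (y - x))\<^sup>2)) (\<lambda>_. True)"

definition composite :: "('a \<Rightarrow> real) \<Rightarrow> ('a \<Rightarrow> ereal) \<Rightarrow> 'a \<Rightarrow> ereal" where
  "composite f g x = ereal (f x) + g x"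

text \<open>
  Only meaningful for \<open>x\<close> with finite \<open>g x\<close>, since \<^typ>\<open>ereal\<close> subtraction sets
  $\infty - \infty = \infty$.
\<close>

definition gen_grad_size ::
    "('a::real_inner \<Rightarrow> real) \<Rightarrow> ('a \<Rightarrow> ereal) \<Rightarrow> 'a \<Rightarrow> real \<Rightarrow> ereal" where
  "gen_grad_size f g x \<alpha> =
     ereal (- 2 * \<alpha>) *
     min_value (\<lambda>y. ereal (grad f x \<bullet> (y - x) + \<alpha> / 2 * (norm (y - x))\<^sup>2) + (g y - g x))"

definition restricted_prox_PL ::
    "('a::real_inner \<Rightarrow> real) \<Rightarrow> ('a \<Rightarrow> ereal) \<Rightarrow> real \<Rightarrow> 'a set \<Rightarrow> real \<Rightarrow> bool" where
  "restricted_prox_PL f g L K \<nu> \<longleftrightarrow>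
     \<nu> > 0 \<and>
     (\<forall>x \<in> K \<inter> effective_domain (composite f g).
        ereal (1 / 2) * gen_grad_size f g x L
          \<ge> ereal \<nu> * (composite f g x - min_value (composite f g)))"

end

theory Submission
  imports Defs
begin

text \<open>
  Completing the square, the objective minimised by the proximal step and the quadratic model in
  \<open>\<D>\<^sub>g(x\<^sub>k, L)\<close> differ by a constant, so the minimum in \<open>\<D>\<^sub>g(x\<^sub>k, L)\<close> is attained at
  \<open>x\<^sub>k\<^sub>+\<^sub>1\<close>. The descent lemma bounds \<open>F(x\<^sub>k\<^sub>+\<^sub>1) - F(x\<^sub>k)\<close> by the value of the model there,
  and the PL inequality bounds that value by \<open>- \<nu>/L (F(x\<^sub>k) - F\<^sup>*)\<close>.
  The descent lemma and \<open>F \<ge> F\<^sup>*\<close> also bound the proximal objective from below; by strong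
  convexity its minimising sequences are Cauchy, so the proximal point exists.
\<close>

text \<open>Riesz representation in coordinates: a linear functional is the inner product with the
  vector \<open>D\<close> of its values on \<open>Basis\<close>. Uniqueness of derivatives then lets
  the definite description in \<open>grad\<close> pick out \<open>D\<close>.\<close>

lemma GDERIV_grad:
  fixes f :: "'a::euclidean_space \<Rightarrow> real"
  assumes "f differentiable (at x)"
  shows "GDERIV f x :> grad f x"
proof -
  obtain f' where f': "(f has_derivative f') (at x)"
    using assms by (auto simp: differentiable_def)
  then have lin: "linear f'"
    by (rule has_derivative_linear)
  define D where "D = (\<Sum>b\<in>Basis. f' b *\<^sub>R b)"
  have "f' h = h \<bullet> D" for h
  proof -
    have "f' h = f' (\<Sum>b\<in>Basis. (h \<bullet> b) *\<^sub>R b)"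
      by (simp add: euclidean_representation)
    also have "\<dots> = h \<bullet> D"
      by (simp add: linear_sum[OF lin] linear_cmul[OF lin] D_def inner_sum_right mult.commute)
    finally show ?thesis .
  qed
  then have "f' = (\<lambda>h. h \<bullet> D)"
    by blast
  with f' have D: "GDERIV f x :> D"
    by (simp add: gderiv_def)
  have unique: "D' = D" if "GDERIV f x :> D'" for D'
  proof -
    have "(\<lambda>h. h \<bullet> D') = (\<lambda>h. h \<bullet> D)"
      using that D has_derivative_unique unfolding gderiv_def by blast
    then have "\<forall>h. h \<bullet> D' = h \<bullet> D"
      by (simp add: fun_eq_iff)
    then show ?thesis
      by (rule iffD1[OF vector_eq_ldot])
  qed
  have "grad f x = D"
    unfolding grad_def
    by (rule the_equality[where P = "\<lambda>D. GDERIV f x :> D", OF D unique])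
  with D show ?thesis
    by simp
qed

text \<open>The descent lemma. Along the segment from \<open>x\<close> to \<open>y\<close>, the
  excess \<open>\<phi>\<close> of \<open>f\<close> over its quadratic model has nonpositive
  derivative, by Cauchy-Schwarz and the Lipschitz bound on the gradient.\<close>

lemma L_smooth_quadratic_upper_bound:
  fixes f :: "'a::euclidean_space \<Rightarrow> real"
  assumes diff: "\<And>x. f differentiable (at x)" and smooth: "L_smooth L f"
  shows "f y \<le> f x + grad f x \<bullet> (y - x) + L / 2 * (norm (y - x))\<^sup>2"
proof -
  define d where "d = y - x"
  define \<phi> where "\<phi> t = f (x + t *\<^sub>R d) - t * (grad f x \<bullet> d) - L / 2 * t\<^sup>2 * (norm d)\<^sup>2" for t
  have "\<phi> 1 \<le> \<phi> 0"
  proof (rule DERIV_nonpos_imp_nonincreasing[of 0 1 \<phi>])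
    fix t :: real
    assume t: "0 \<le> t" "t \<le> 1"
    let ?z = "x + t *\<^sub>R d"
    have line: "((\<lambda>t. x + t *\<^sub>R d) has_derivative (\<lambda>h. h *\<^sub>R d)) (at t)"
      by (auto intro!: derivative_eq_intros)
    have "(f has_derivative (\<lambda>h. h \<bullet> grad f ?z)) (at ?z)"
      using GDERIV_grad[OF diff] by (simp add: gderiv_def)
    from diff_chain_at[OF line this]
    have "((\<lambda>t. f (x + t *\<^sub>R d)) has_real_derivative grad f ?z \<bullet> d) (at t)"
      by (simp add: o_def has_field_derivative_def inner_commute mult_commute_abs)
    then have "(\<phi> has_real_derivative grad f ?z \<bullet> d - grad f x \<bullet> d - L * t * (norm d)\<^sup>2) (at t)"
      unfolding \<phi>_def by (auto intro!: derivative_eq_intros)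
    moreover have "(grad f ?z - grad f x) \<bullet> d \<le> L * t * (norm d)\<^sup>2"
    proof -
      have "(grad f ?z - grad f x) \<bullet> d \<le> norm (grad f ?z - grad f x) * norm d"
        by (rule norm_cauchy_schwarz)
      also have "\<dots> \<le> (L * norm (?z - x)) * norm d"
        using smooth unfolding L_smooth_def by (meson mult_right_mono norm_ge_zero)
      finally show ?thesis
        using t by (simp add: power2_eq_square mult.assoc)
    qed
    ultimately show "\<exists>D. (\<phi> has_real_derivative D) (at t) \<and> D \<le> 0"
      by (intro exI conjI) (auto simp: inner_diff_left)
  qed simp
  then show ?thesis
    by (simp add: \<phi>_def d_def)
qed

text \<open>The parallelogram law centred at \<open>z\<close>; the last term is the strong convexity
  of the squared distance.\<close>

lemma norm_midpoint_diff_sq: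
  fixes y y' z :: "'a::real_inner"
  shows "(norm ((1/2) *\<^sub>R y + (1/2) *\<^sub>R y' - z))\<^sup>2
           = ((norm (y - z))\<^sup>2 + (norm (y' - z))\<^sup>2) / 2 - (norm (y - y'))\<^sup>2 / 4"
  unfolding power2_norm_eq_inner
  by (simp add: inner_add_left inner_add_right inner_diff_left inner_diff_right inner_commute
      field_simps)

lemma ex_is_arg_min_prox_objective:
  fixes g :: "'a::{real_inner,banach} \<Rightarrow> ereal"
  assumes a: "a > 0" and "proper_fun g" and "closed_fun g" and "convex_fun g"
    and lower: "\<And>y. ereal b \<le> g y + ereal (a * (norm (y - z))\<^sup>2)"
  shows "\<exists>p. is_arg_min (\<lambda>y. g y + ereal (a * (norm (y - z))\<^sup>2)) (\<lambda>_. True) p"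
proof -
  \<comment> \<open>Minimising over points of the epigraph, with the height \<open>t\<close> in
    place of \<open>g y\<close>, keeps all values real and uses closedness and convexity in the form
    in which they are defined.\<close>
  define h where "h = (\<lambda>(y, t). t + a * (norm (y - z))\<^sup>2)"
  define m where "m = Inf (h ` epi g)"
  have lb: "b \<le> h p" if mem: "p \<in> epi g" for p
  proof -
    obtain y t where p: "p = (y, t)" "g y \<le> ereal t"
      using mem by (auto simp: epi_def)
    then have "g y + ereal (a * (norm (y - z))\<^sup>2) \<le> ereal (h p)"
      using add_right_mono[of "g y" "ereal t" "ereal (a * (norm (y - z))\<^sup>2)"]
      by (simp add: h_def)
    with lower[of y] have "ereal b \<le> ereal (h p)"
      by (rule order_trans)
    then show ?thesis
      by simp
  qed
  have ne: "epi g \<noteq> {}"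
  proof -
    obtain y r where "g y = ereal r"
      using \<open>proper_fun g\<close> unfolding proper_fun_def by (metis ereal_cases)
    then have "(y, r) \<in> epi g"
      by (simp add: epi_def)
    then show ?thesis
      by blast
  qed
  have m_le: "m \<le> h p" if "p \<in> epi g" for p
    unfolding m_def using lb that by (intro cINF_lower bdd_belowI2) auto
  have "\<exists>p\<in>epi g. h p < m + inverse (real (Suc n))" for n
    using cInf_lessD[of "h ` epi g" "m + inverse (real (Suc n))"] ne by (auto simp: m_def)
  then obtain p where p: "\<And>n. p n \<in> epi g" "\<And>n. h (p n) < m + inverse (real (Suc n))"
    by metis
  define y where "y n = fst (p n)" for n
  define t where "t n = snd (p n)" for n
  have h_p: "h (p n) = t n + a * (norm (y n - z))\<^sup>2" for n
    by (simp add: h_def y_def t_def split_beta)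
  have h_lim: "(\<lambda>n. h (p n)) \<longlonglongrightarrow> m"
  proof (rule tendsto_sandwich)
    show "\<forall>\<^sub>F n in sequentially. m \<le> h (p n)"
      by (simp add: m_le p(1))
    show "\<forall>\<^sub>F n in sequentially. h (p n) \<le> m + inverse (real (Suc n))"
      by (intro always_eventually allI less_imp_le p(2))
    show "(\<lambda>n. m + inverse (real (Suc n))) \<longlonglongrightarrow> m"
      using tendsto_add[OF tendsto_const LIMSEQ_inverse_real_of_nat, of m] by simp
  qed simp
  \<comment> \<open>The midpoint of \<open>p i\<close> and \<open>p j\<close> stays in the convex
    epigraph, so \<open>h\<close> is at least \<open>m\<close> there; the midpoint identity turns
    this into a bound on the distance.\<close>
  have gap: "a / 4 * (norm (y i - y j))\<^sup>2 \<le> (h (p i) - m) / 2 + (h (p j) - m) / 2" for i j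
  proof -
    have "(1/2) *\<^sub>R p i + (1/2) *\<^sub>R p j \<in> epi g"
      using \<open>convex_fun g\<close> p unfolding convex_fun_def by (intro convexD) auto
    from m_le[OF this]
    have "m \<le> (t i + t j) / 2 + a * (norm ((1/2) *\<^sub>R y i + (1/2) *\<^sub>R y j - z))\<^sup>2"
      by (simp add: h_def split_beta y_def t_def add_divide_distrib)
    then show ?thesis
      unfolding norm_midpoint_diff_sq h_p by (simp add: field_simps)
  qed
  have "Cauchy y"
  proof (rule CauchyI)
    fix e :: real
    assume e: "e > 0"
    then have "a / 4 * e\<^sup>2 > 0"
      using a by simp
    from order_tendstoD(2)[OF h_lim, of "m + a / 4 * e\<^sup>2"] this
    obtain N where N: "\<And>n. n \<ge> N \<Longrightarrow> h (p n) < m + a / 4 * e\<^sup>2"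
      by (auto simp: eventually_sequentially)
    have "norm (y i - y j) < e" if "i \<ge> N" "j \<ge> N" for i j
    proof -
      have "a / 4 * (norm (y i - y j))\<^sup>2 < a / 4 * e\<^sup>2"
        using gap[of i j] N[OF that(1)] N[OF that(2)] by argo
      then have "(norm (y i - y j))\<^sup>2 < e\<^sup>2"
        using a by simp
      then show ?thesis
        using e by (simp add: power2_less_imp_less)
    qed
    then show "\<exists>M. \<forall>i\<ge>M. \<forall>j\<ge>M. norm (y i - y j) < e"
      by blast
  qed
  then obtain q where q: "y \<longlonglongrightarrow> q"
    using Cauchy_convergent_iff convergent_def by blast
  \<comment> \<open>The heights converge because both \<open>h (p n)\<close> and the quadratic term
    do; closedness then keeps the limit pair \<open>(q, s)\<close>, at which \<open>h\<close> equals
    \<open>m\<close>, in the epigraph.\<close>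
  define s where "s = m - a * (norm (q - z))\<^sup>2"
  have "(\<lambda>n. h (p n) - a * (norm (y n - z))\<^sup>2) \<longlonglongrightarrow> s"
    unfolding s_def by (intro tendsto_intros h_lim q)
  then have "t \<longlonglongrightarrow> s"
    by (simp add: h_p)
  then have "p \<longlonglongrightarrow> (q, s)"
    using tendsto_Pair[OF q, of t s] by (simp add: y_def t_def)
  then have "(q, s) \<in> epi g"
    using closed_sequentially[of "epi g" p "(q, s)"] \<open>closed_fun g\<close> p(1)
    by (auto simp: closed_fun_def)
  then have "g q \<le> ereal s"
    by (simp add: epi_def)
  then have "g q + ereal (a * (norm (q - z))\<^sup>2) \<le> ereal m"
    using add_right_mono[of "g q" "ereal s" "ereal (a * (norm (q - z))\<^sup>2)"] by (simp add: s_def)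
  moreover have "ereal m \<le> g x + ereal (a * (norm (x - z))\<^sup>2)" for x
  proof (cases "g x")
    case (real r)
    then show ?thesis
      using m_le[of "(x, r)"] by (simp add: epi_def h_def)
  qed (use \<open>proper_fun g\<close> in \<open>auto simp: proper_fun_def\<close>)
  ultimately have "g q + ereal (a * (norm (q - z))\<^sup>2) \<le> g x + ereal (a * (norm (x - z))\<^sup>2)"
    for x
    by (rule order_trans)
  then show ?thesis
    by (auto simp: is_arg_min_linorder)
qed

text \<open>\<open>arg_min\<close> is a Hilbert choice, so only the existence of a minimiser gives
  it meaning.\<close>

lemma is_arg_min_arg_min:
  assumes "\<exists>x. is_arg_min f P x"
  shows "is_arg_min f P (arg_min f P)"
  unfolding arg_min_def using assms by (rule someI_ex)

lemma min_value_eq: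
  assumes "\<And>y. F p \<le> F y"
  shows "min_value F = F p"
  unfolding min_value_def using assms by (intro Least_equality) auto

lemma prox_step_square:
  fixes x y v :: "'a::real_inner"
  assumes "L > 0"
  shows "L / 2 * (norm (y - (x - (1 / L) *\<^sub>R v)))\<^sup>2
           = v \<bullet> (y - x) + L / 2 * (norm (y - x))\<^sup>2 + (norm v)\<^sup>2 / (2 * L)"
proof -
  have "y - (x - (1 / L) *\<^sub>R v) = (y - x) + (1 / L) *\<^sub>R v"
    by simp
  then show ?thesis
    unfolding power2_norm_eq_inner using assms
    by (simp only: inner_add_left inner_add_right inner_commute) (simp add: field_simps inner_commute)
qed

theorem theorem1:
  fixes f :: "real ^ 'd \<Rightarrow> real"
    and g :: "real ^ 'd \<Rightarrow> ereal"
    and F :: "real ^ 'd \<Rightarrow> ereal"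
    and K :: "(real ^ 'd) set"
    and L \<nu> Fstar :: real
    and x_k x_next :: "real ^ 'd"
  assumes "continuously_differentiable f"
    and "L_smooth L f"
    and "proper_fun g" and "closed_fun g" and "convex_fun g"
    and "F = composite f g"
    and "minimizers F \<noteq> {}" and "min_value F = ereal Fstar"
    and "restricted_prox_PL f g L K \<nu>"
    and "x_k \<in> K"
    and "x_next = prox (1 / L) g (x_k - (1 / L) *\<^sub>R grad f x_k)"
  shows "F x_next - ereal Fstar
           \<le> (if F x_k = \<infinity> then \<infinity> else ereal (1 - \<nu> / L) * (F x_k - ereal Fstar))"
proof (cases "F x_k = \<infinity>")
  case False
  have L: "L > 0"
    using assms(2) by (simp add: L_smooth_def)
  have g_ninf: "g y \<noteq> -\<infinity>" for y
    using assms(3) by (auto simp: proper_fun_def)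
  define v where "v = grad f x_k"
  define z where "z = x_k - (1 / L) *\<^sub>R v"
  define c where "c = (norm v)\<^sup>2 / (2 * L)"
  define \<psi> where "\<psi> y = v \<bullet> (y - x_k) + L / 2 * (norm (y - x_k))\<^sup>2" for y
  define Q where "Q = (\<lambda>y. g y + ereal (L / 2 * (norm (y - z))\<^sup>2))"
  have Q: "Q y = g y + ereal (\<psi> y + c)" for y
    unfolding Q_def z_def \<psi>_def c_def prox_step_square[OF L] by simp
  have descent: "f y \<le> f x_k + \<psi> y" for y
    using L_smooth_quadratic_upper_bound[of f L y x_k] assms(1,2)
    by (simp add: continuously_differentiable_def v_def \<psi>_def)
  obtain r where r: "g x_k = ereal r"
    using False g_ninf[of x_k] by (cases "g x_k") (auto simp: assms(6) composite_def)
  have F_ge: "ereal Fstar \<le> F y" for y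
  proof -
    obtain p where p: "\<And>y. F p \<le> F y"
      using assms(7) by (auto simp: minimizers_def is_arg_min_linorder)
    then have "F p = ereal Fstar"
      using min_value_eq[of F p] assms(8) by simp
    with p[of y] show ?thesis
      by simp
  qed
  \<comment> \<open>The constant comes from
    \<open>Fstar \<le> f y + g y \<le> f x_k + \<psi> y + g y\<close>, the last sum being
    \<open>f x_k + Q y - c\<close>.\<close>
  have lower: "ereal (Fstar - f x_k + c) \<le> Q y" for y
  proof (cases "g y")
    case (real s)
    then have "Fstar \<le> f y + s"
      using F_ge[of y] by (simp add: assms(6) composite_def)
    with descent[of y] show ?thesis
      by (simp add: Q real)
  qed (use g_ninf in \<open>auto simp: Q\<close>)
  \<comment> \<open>For step size \<open>1 / L\<close>, the weight \<open>1 / (2 * c)\<close> in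
    \<open>prox\<close> becomes \<open>L / 2\<close>.\<close>
  have "x_next = arg_min Q (\<lambda>_. True)"
    unfolding assms(11) prox_def Q_def z_def v_def by simp
  moreover have "\<exists>p. is_arg_min Q (\<lambda>_. True) p"
    unfolding Q_def using L assms(3-5) lower[unfolded Q_def]
    by (intro ex_is_arg_min_prox_objective) auto
  ultimately have "is_arg_min Q (\<lambda>_. True) x_next"
    using is_arg_min_arg_min by metis
  then have min: "Q x_next \<le> Q y" for y
    by (simp add: is_arg_min_linorder)
  \<comment> \<open>Comparison with the finite value \<open>Q x_k\<close> rules out an infinite
    \<open>g x_next\<close>.\<close>
  obtain s where s: "g x_next = ereal s"
    using min[of x_k] g_ninf[of x_next] by (cases "g x_next") (auto simp: Q r)
  \<comment> \<open>The two objectives differ by the finite constant \<open>c + g x_k\<close>, so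
    the minimiser carries over.\<close>
  have model_min: "ereal (\<psi> x_next) + (g x_next - g x_k) \<le> ereal (\<psi> y) + (g y - g x_k)" for y
    using min[of y] g_ninf[of y] by (cases "g y") (auto simp: Q r s)
  have "gen_grad_size f g x_k L = ereal (- 2 * L * (\<psi> x_next + (s - r)))"
    using min_value_eq[of "\<lambda>y. ereal (\<psi> y) + (g y - g x_k)", OF model_min]
    unfolding gen_grad_size_def by (simp add: \<psi>_def v_def r s)
  moreover have "ereal \<nu> * (F x_k - ereal Fstar) \<le> ereal (1 / 2) * gen_grad_size f g x_k L"
    using assms(6,8,9,10) False
    by (auto simp: restricted_prox_PL_def effective_domain_def)
  ultimately have "\<nu> * (f x_k + r - Fstar) \<le> - (L * (\<psi> x_next + (s - r)))"
    by (simp add: assms(6) composite_def r)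
  then have "\<psi> x_next + (s - r) \<le> - (\<nu> / L * (f x_k + r - Fstar))"
    using L by (simp add: field_simps)
  \<comment> \<open>The descent lemma gives
    \<open>f x_next + s \<le> f x_k + r + (\<psi> x_next + (s - r))\<close>, whose bracket has just
    been bounded.\<close>
  with descent[of x_next]
  have "f x_next + s - Fstar \<le> (1 - \<nu> / L) * (f x_k + r - Fstar)"
    by (simp add: left_diff_distrib)
  with False show ?thesis
    by (simp add: assms(6) composite_def r s)
qed simp

end
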